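(* Let $n$ be a positive integer with $\omega(n)\ge 2$. Then the girth of $\tilde{\Gamma}_{\mathcal{H}}(\mathbb{Z}_n)$ is given by $$gr(\tilde{\Gamma}_{\mathcal{H}}(\mathbb{Z}_n))=\begin{cases}\infty, & \text{if } n=p_1^{\alpha_1}p_2 \text{ with } \alpha_1\ge 1, \text{ or } n=p_1p_2p_3,\\ 4, & \text{if } n=p_1^{\alpha_1}p_2^{\alpha_2} \text{ with } \alpha_1,\alpha_2\ge 2,\\ 2, & \text{otherwise},\end{cases}$$ where $p_1,p_2,p_3$ denote distinct primes and $\alpha_1,\alpha_2$ are integers.
   Context: $\omega(n)$ denotes the number of distinct prime divisors of $n$. A hypergraph is a pair $(V,E)$ with $E$ a set of subsets of $V$ (hyperedges). For a group $G$ with identity $e$, let $S$ be the set of all non-trivial proper subgroups of $G$. The intersection hypergraph $\tilde{\Gamma}_{\mathcal{H}}(G)$ has vertex set $V=\{H\in S : H\cap K=\{e\}\text{ for some }K\in S\}$, and $E\subseteq V$ is a hyperedge if and only if (1) for distinct $H,K\in E$, $H\cap K=\{e\}$; and (2) there is no $E'\subseteq V$ with $E'\supsetneq E$ satisfying (1). A path in a hypergraph is an alternating sequence $v_1e_1v_2e_2\ldots v_k$ of distinct vertices and distinct hyperedges with $v_i,v_{i+1}\in e_i$ for $1\le i\le k-1$; its length is its number of hyperedges. A cycle is such a sequence whose first vertex equals its last vertex (the vertices being otherwise distinct and the hyperedges distinct), of length at least $2$. The girth $gr$ is the length of a shortest cycle contained in the hypergraph, and is $\infty$ if there is no cycle.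 *)

theory Defs
  imports
    "HOL-Algebra.Elementary_Groups"
    "HOL-Computational_Algebra.Primes"
    "HOL-Library.Extended_Nat"
begin

type_synonym 'a hypergraph = "'a set \<times> 'a set set"

abbreviation (input) hverts :: "'a hypergraph \<Rightarrow> 'a set"
  where "hverts \<equiv> fst"

abbreviation (input) hedges :: "'a hypergraph \<Rightarrow> 'a set set"
  where "hedges \<equiv> snd"

text \<open>
  The alternating sequence \<open>v\<^sub>0 e\<^sub>0 v\<^sub>1 e\<^sub>1 \<dots> e\<^sub>k\<^sub>-\<^sub>1 v\<^sub>k\<close> is given by its list \<open>vs\<close> of \<open>k + 1\<close>
  vertices, which repeats the starting vertex at the end, and its list \<open>es\<close> of \<open>k\<close> hyperedges;
  its length is \<open>k = length es\<close>.
\<close>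

definition hcycle :: "'a hypergraph \<Rightarrow> 'a list \<Rightarrow> 'a set list \<Rightarrow> bool"
  where "hcycle \<Gamma> vs es \<longleftrightarrow>
    2 \<le> length es \<and> length vs = length es + 1 \<and>
    set vs \<subseteq> hverts \<Gamma> \<and> set es \<subseteq> hedges \<Gamma> \<and>
    hd vs = last vs \<and> distinct (butlast vs) \<and> distinct es \<and>
    (\<forall>i < length es. vs ! i \<in> es ! i \<and> vs ! (i + 1) \<in> es ! i)"

text \<open>If there is no cycle, this is the infimum of the empty set in \<^typ>\<open>enat\<close>, that is \<open>\<infinity>\<close>.\<close>

definition girth :: "'a hypergraph \<Rightarrow> enat"
  where "girth \<Gamma> = Inf {enat (length es) | vs es. hcycle \<Gamma> vs es}"

definition nontrivial_proper_subgroups :: "('a, 'b) monoid_scheme \<Rightarrow> 'a set set"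
  where "nontrivial_proper_subgroups G =
    {H. subgroup H G \<and> H \<noteq> {\<one>\<^bsub>G\<^esub>} \<and> H \<noteq> carrier G}"

definition intersection_vertices :: "('a, 'b) monoid_scheme \<Rightarrow> 'a set set"
  where "intersection_vertices G =
    {H \<in> nontrivial_proper_subgroups G.
      \<exists>K \<in> nontrivial_proper_subgroups G. H \<inter> K = {\<one>\<^bsub>G\<^esub>}}"

definition trivially_intersecting :: "('a, 'b) monoid_scheme \<Rightarrow> 'a set set \<Rightarrow> bool"
  where "trivially_intersecting G E \<longleftrightarrow> (\<forall>H \<in> E. \<forall>K \<in> E. H \<noteq> K \<longrightarrow> H \<inter> K = {\<one>\<^bsub>G\<^esub>})"

definition intersection_hypergraph :: "('a, 'b) monoid_scheme \<Rightarrow> 'a set hypergraph"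
  where "intersection_hypergraph G =
    (intersection_vertices G,
     {E. E \<subseteq> intersection_vertices G \<and> trivially_intersecting G E \<and>
       \<not> (\<exists>E'. E' \<subseteq> intersection_vertices G \<and> E \<subset> E' \<and> trivially_intersecting G E')})"

end

theory Submission
  imports Defs "HOL-Algebra.Multiplicative_Group"
begin

text \<open>
  For \<open>d\<close> dividing \<open>n\<close> let \<open>T d\<close> be the subgroup of the elements of \<open>\<int>\<^sub>n\<close> killed by \<open>d\<close>. These are
  all the subgroups, and \<open>T d \<inter> T e = T (gcd d e)\<close>; so the hypergraph lives on the divisors
  \<open>d \<noteq> 1\<close> of \<open>n\<close> that miss some prime divisor of \<open>n\<close>, and its hyperedges are the pairwise coprime
  families in which every prime divisor of \<open>n\<close> divides some member. With two primes \<open>p, q\<close>, the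
  hyperedges are the pairs \<open>{p^i, q^j}\<close>, that is, a complete bipartite graph, which is a star if one
  exponent is \<open>1\<close>. If \<open>n = pqr\<close>, only \<open>p, q, r\<close> lie in more than one hyperedge, and any two of them
  share just \<open>{p, q, r}\<close>. In all other cases there are prime divisors \<open>r, s\<close> (possibly equal) with
  \<open>rs\<close> dividing \<open>n\<close> and two further prime divisors \<open>p, q\<close>; completing \<open>r\<close> and \<open>rs\<close> to hyperedges by
  primes gives two distinct hyperedges that both contain \<open>p\<close> and \<open>q\<close>.
\<close>

subsection \<open>Cycles and girth\<close>

text \<open>Both distinctness conditions survive the mapping: \<open>f\<close> is injective on the
  vertices, and hence taking images under \<open>f\<close> is injective on the hyperedges, which all
  lie in \<open>Pow V\<close>.\<close>

lemma hcycle_image: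
  assumes "inj_on f V" "\<Union>E \<subseteq> V" "hcycle (V, E) vs es"
  shows "hcycle (f ` V, (`) f ` E) (map f vs) (map ((`) f) es)"
proof -
  note c = assms(3)[unfolded hcycle_def fst_conv snd_conv]
  have vs: "vs \<noteq> []" using c by auto
  have "inj_on ((`) f) (set es)"
    using assms(1,2) c by (intro inj_on_subset[OF inj_on_image_Pow[OF assms(1)]]) blast
  moreover have "inj_on f (set (butlast vs))"
    using c by (intro inj_on_subset[OF assms(1)]) (auto dest: in_set_butlastD)
  ultimately show ?thesis
    using c vs unfolding hcycle_def fst_conv snd_conv
    by (auto simp: distinct_map map_butlast[symmetric] hd_map last_map)
qed

text \<open>Cycles also travel back along \<open>inv_into V f\<close>, so the two hypergraphs have
  the same set of cycle lengths.\<close>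

lemma girth_image:
  assumes "inj_on f V" "\<Union>E \<subseteq> V"
  shows "girth (f ` V, (`) f ` E) = girth (V, E)"
proof -
  let ?g = "inv_into V f"
  have V: "?g ` f ` V = V"
    using assms(1) by (simp add: image_inv_into_cancel)
  have E: "(`) ?g ` (`) f ` E = E"
  proof -
    have "?g ` f ` e = e" if "e \<in> E" for e
      using assms that by (intro inv_into_image_cancel) auto
    then show ?thesis by (force simp: image_image)
  qed
  have inv: "hcycle (V, E) (map ?g vs) (map ((`) ?g) es)"
    if "hcycle (f ` V, (`) f ` E) vs es" for vs es
    using hcycle_image[of ?g "f ` V" "(`) f ` E" vs es] that assms(2) V E
    by (auto simp: inj_on_inv_into)
  have "{enat (length es) | vs es. hcycle (f ` V, (`) f ` E) vs es}
      = {enat (length es) | vs es. hcycle (V, E) vs es}" (is "?L = ?R")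
  proof
    show "?L \<subseteq> ?R" using inv by clarsimp (metis length_map)
    show "?R \<subseteq> ?L" using hcycle_image[OF assms] by clarsimp (metis length_map)
  qed
  then show ?thesis by (simp add: girth_def)
qed

lemma girth_le: "hcycle \<Gamma> vs es \<Longrightarrow> girth \<Gamma> \<le> enat (length es)"
  unfolding girth_def by (rule Inf_lower) blast

lemma girth_geI:
  assumes "\<And>vs es. hcycle \<Gamma> vs es \<Longrightarrow> k \<le> length es"
  shows "enat k \<le> girth \<Gamma>"
  unfolding girth_def by (rule Inf_greatest) (use assms in auto)

lemma girth_infinityI:
  assumes "\<And>vs es. \<not> hcycle \<Gamma> vs es"
  shows "girth \<Gamma> = \<infinity>"
  using assms by (simp add: girth_def top_enat_def)

text \<open>Two hyperedges sharing two vertices form the cycle \<open>u e v e' u\<close>, and no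
  cycle is shorter than 2 by definition.\<close>

lemma girth_eq_2I:
  assumes "e \<in> snd \<Gamma>" "e' \<in> snd \<Gamma>" "e \<noteq> e'" "u \<noteq> v" "{u, v} \<subseteq> e \<inter> e'" "{u, v} \<subseteq> fst \<Gamma>"
  shows "girth \<Gamma> = 2"
proof (rule antisym)
  have "hcycle \<Gamma> [u, v, u] [e, e']"
    using assms by (auto simp: hcycle_def less_Suc_eq)
  from girth_le[OF this] show "girth \<Gamma> \<le> 2" by (simp add: numeral_eq_enat eval_nat_numeral)
  have "enat 2 \<le> girth \<Gamma>" by (rule girth_geI) (simp add: hcycle_def)
  then show "2 \<le> girth \<Gamma>" by (simp add: numeral_eq_enat eval_nat_numeral)
qed

lemma hcycle_nth_edge:
  assumes "hcycle \<Gamma> vs es" "i < length es"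
  shows "es ! i \<in> snd \<Gamma>" "vs ! i \<in> es ! i" "vs ! Suc i \<in> es ! i"
  using assms by (auto simp: hcycle_def dest: nth_mem)

lemma hcycle_nth_edge_eq_iff:
  assumes "hcycle \<Gamma> vs es" "i < length es" "j < length es"
  shows "es ! i = es ! j \<longleftrightarrow> i = j"
  using assms by (simp add: hcycle_def nth_eq_iff_index_eq)

text \<open>The only coincidence among the positions of a cycle is between the first and the last
  one, and the final hypothesis excludes exactly this pair.\<close>

lemma hcycle_nth_neq:
  assumes "hcycle \<Gamma> vs es" "i < j" "j \<le> length es" "i \<noteq> 0 \<or> j < length es"
  shows "vs ! i \<noteq> vs ! j"
proof (cases "j < length es")
  case True
  have "butlast vs ! i \<noteq> butlast vs ! j"
    using assms True by (subst nth_eq_iff_index_eq) (auto simp: hcycle_def)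
  then show ?thesis
    using assms True by (auto simp: hcycle_def nth_butlast)
next
  case False
  then have "vs ! j = vs ! 0"
    using assms by (cases "vs = []") (auto simp: hcycle_def hd_conv_nth last_conv_nth)
  moreover have "vs ! i \<noteq> vs ! 0"
  proof -
    have len: "length (butlast vs) = length es" and dist: "distinct (butlast vs)"
      using assms by (simp_all add: hcycle_def)
    have i: "i < length es" "0 < length es" "i \<noteq> 0" using assms(2-4) False by linarith+
    then show ?thesis
      using nth_eq_iff_index_eq[OF dist, unfolded len, OF i(1,2)]
        nth_butlast[of i vs, unfolded len] nth_butlast[of 0 vs, unfolded len] by simp
  qed
  ultimately show ?thesis by simp
qed

text \<open>A vertex lies in the hyperedge that follows it and in the one that precedes it
  cyclically; these differ because a cycle has at least two hyperedges.\<close>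

lemma hcycle_two_edges:
  assumes "hcycle \<Gamma> vs es" "v \<in> set vs"
  shows "\<exists>e \<in> snd \<Gamma>. \<exists>e' \<in> snd \<Gamma>. e \<noteq> e' \<and> v \<in> e \<and> v \<in> e'"
proof -
  note c = assms(1)[unfolded hcycle_def]
  have last: "vs ! length es = vs ! 0"
    using c by (cases "vs = []") (auto simp: hd_conv_nth last_conv_nth)
  \<comment> \<open>The final position is traded for position 0, which carries the same vertex, so
    that \<open>i\<close> also indexes a hyperedge.\<close>
  obtain i where i: "i < length es" "v = vs ! i"
  proof -
    obtain i where "i \<le> length es" "v = vs ! i"
      using assms(2) c by (metis in_set_conv_nth less_Suc_eq_le Suc_eq_plus1)
    then show ?thesis
      using that[of i] that[of 0] last c by (cases "i = length es") fastforce+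
  qed
  \<comment> \<open>The cyclic predecessor of \<open>i\<close>: the hyperedge before position 0 is
    the last one.\<close>
  define j where "j = (if i = 0 then length es - 1 else i - 1)"
  have "j < length es" "j \<noteq> i" "vs ! (j + 1) = v"
    using i c last by (auto simp: j_def)
  moreover from this(1,2) have "es ! j \<noteq> es ! i"
    using hcycle_nth_edge_eq_iff[OF assms(1)] i(1) by simp
  ultimately show ?thesis
    using hcycle_nth_edge[OF assms(1)] i by (metis Suc_eq_plus1)
qed

text \<open>
  Every vertex of a cycle lies in two distinct hyperedges, so the first two hyperedges of a cycle
  are distinct and each contains two such vertices.
\<close>

lemma girth_infinityI_two_edges:
  assumes "\<And>e e' u v u' v'. \<lbrakk>e \<in> snd \<Gamma>; e' \<in> snd \<Gamma>; {u, v} \<subseteq> e; {u', v'} \<subseteq> e'; u \<noteq> v; u' \<noteq> v';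
      {u, v, u', v'} \<subseteq> {x. \<exists>e \<in> snd \<Gamma>. \<exists>e' \<in> snd \<Gamma>. e \<noteq> e' \<and> x \<in> e \<and> x \<in> e'}\<rbrakk> \<Longrightarrow> e = e'"
  shows "girth \<Gamma> = \<infinity>"
proof (rule girth_infinityI, rule notI)
  fix vs es assume h: "hcycle \<Gamma> vs es"
  then have len: "0 < length es" "1 < length es" "length vs = length es + 1"
    by (auto simp: hcycle_def)
  let ?B = "{x. \<exists>e \<in> snd \<Gamma>. \<exists>e' \<in> snd \<Gamma>. e \<noteq> e' \<and> x \<in> e \<and> x \<in> e'}"
  have B: "vs ! i \<in> ?B" if "i \<le> 2" for i
  proof -
    have "vs ! i \<in> set vs" using that len by (intro nth_mem) linarith
    from hcycle_two_edges[OF h this] show ?thesis by (rule CollectI)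
  qed
  have "es ! 0 = es ! 1"
  proof (rule assms)
    show "es ! 0 \<in> snd \<Gamma>" "es ! 1 \<in> snd \<Gamma>"
      using hcycle_nth_edge(1)[OF h] len by blast+
    show "{vs ! 0, vs ! 1} \<subseteq> es ! 0" "{vs ! 1, vs ! 2} \<subseteq> es ! 1"
      using hcycle_nth_edge(2,3)[OF h len(1)] hcycle_nth_edge(2,3)[OF h len(2)]
      by (simp_all add: numeral_2_eq_2)
    \<comment> \<open>Only consecutive vertices are compared: in a cycle of length 2,
      \<open>vs ! 2\<close> is \<open>vs ! 0\<close> again.\<close>
    show "vs ! 0 \<noteq> vs ! 1" "vs ! 1 \<noteq> vs ! 2"
      using hcycle_nth_neq[OF h, of 0 1] hcycle_nth_neq[OF h, of 1 2] len by simp_all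
    show "{vs ! 0, vs ! 1, vs ! 1, vs ! 2} \<subseteq> ?B"
      unfolding insert_subset using B[of 0] B[of 1] B[of 2] by (intro conjI empty_subsetI) simp_all
  qed
  then show False using hcycle_nth_edge_eq_iff[OF h len(1,2)] by simp
qed

text \<open>The hypergraph is a simple bipartite graph with sides \<open>X\<close> and its
  complement. Simplicity rules out length 2, bipartiteness rules out length 3, and
  \<open>a b c d\<close> is a 4-cycle.\<close>

lemma girth_eq_4I:
  assumes "distinct [a, b, c, d]" "{a, b, c, d} \<subseteq> fst \<Gamma>"
    "{a, b} \<in> snd \<Gamma>" "{b, c} \<in> snd \<Gamma>" "{c, d} \<in> snd \<Gamma>" "{d, a} \<in> snd \<Gamma>"
    and edge: "\<And>e. e \<in> snd \<Gamma> \<Longrightarrow> \<exists>x y. e = {x, y} \<and> x \<in> X \<and> y \<notin> X"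
  shows "girth \<Gamma> = 4"
proof (rule antisym)
  have "hcycle \<Gamma> [a, b, c, d, a] [{a, b}, {b, c}, {c, d}, {d, a}]"
    using assms(1-6) by (auto simp: hcycle_def less_Suc_eq doubleton_eq_iff)
  from girth_le[OF this] show "girth \<Gamma> \<le> 4" by (simp add: numeral_eq_enat eval_nat_numeral)
  have "enat 4 \<le> girth \<Gamma>"
  proof (rule girth_geI, rule ccontr)
    fix vs es assume h: "hcycle \<Gamma> vs es" and "\<not> 4 \<le> length es"
    then have len: "length es = 2 \<or> length es = 3" by (auto simp: hcycle_def)
    have last: "vs ! length es = vs ! 0"
      using h by (cases "vs = []") (auto simp: hcycle_def hd_conv_nth last_conv_nth)
    \<comment> \<open>Consecutive vertices of the cycle differ, so they exhaust the two-element
      hyperedge between them and lie on opposite sides.\<close>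
    have e: "es ! i = {vs ! i, vs ! Suc i}" "vs ! i \<in> X \<longleftrightarrow> vs ! Suc i \<notin> X" if "i < length es" for i
    proof -
      have "vs ! i \<noteq> vs ! Suc i"
        using hcycle_nth_neq[OF h, of i "Suc i"] that len by (cases "i = 0") auto
      then show "es ! i = {vs ! i, vs ! Suc i}" "vs ! i \<in> X \<longleftrightarrow> vs ! Suc i \<notin> X"
        using edge[OF hcycle_nth_edge(1)[OF h that]] hcycle_nth_edge(2,3)[OF h that] by auto
    qed
    from len show False
    proof
      \<comment> \<open>Both hyperedges would be the same pair of vertices.\<close>
      assume l: "length es = 2"
      then have "es ! 0 = es ! 1"
        using e(1)[of 0] e(1)[of 1] last by (simp add: numeral_2_eq_2 insert_commute)
      then show False using hcycle_nth_edge_eq_iff[OF h, of 0 1] l by simp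
    next
      \<comment> \<open>Three changes of side cannot lead back to the starting vertex.\<close>
      assume "length es = 3"
      then show False
        using e(2)[of 0] e(2)[of 1] e(2)[of 2] last by (simp add: numeral_2_eq_2 numeral_3_eq_3)
    qed
  qed
  then show "4 \<le> girth \<Gamma>" by (simp add: numeral_eq_enat)
qed

subsection \<open>Subgroups of the integers modulo n\<close>

text \<open>Written with the representatives that form the carrier of
  \<open>integer_mod_group n\<close> for \<open>n > 0\<close>. The index is the order of the
  subgroup when it divides \<open>n\<close>, rather than a generator, so that intersections become
  gcds.\<close>

definition torsion :: "nat \<Rightarrow> nat \<Rightarrow> int set"
  where "torsion n d = {x \<in> {0..<int n}. int n dvd int d * x}"

lemma torsion_1: "n > 0 \<Longrightarrow> torsion n 1 = {0}"
  by (auto simp: torsion_def dest: zdvd_imp_le)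

lemma torsion_self: "torsion n n = {0..<int n}"
  by (auto simp: torsion_def)

lemma finite_torsion: "finite (torsion n d)"
  by (rule finite_subset[of _ "{0..<int n}"]) (auto simp: torsion_def)

text \<open>If \<open>n = d * m\<close>, then \<open>n\<close> divides \<open>d * x\<close> exactly
  when \<open>m\<close> divides \<open>x\<close>, which leaves the \<open>d\<close> multiples of
  \<open>m\<close> below \<open>n\<close>.\<close>

lemma card_torsion:
  assumes "n > 0" "d dvd n"
  shows "card (torsion n d) = d"
proof -
  from assms obtain m where m: "n = d * m" by blast
  with assms have pos: "d > 0" "m > 0" by auto
  have "torsion n d = (\<lambda>k. int m * k) ` {0..<int d}"
  proof (rule Set.set_eqI)
    fix x
    have "x \<in> torsion n d \<longleftrightarrow> int m dvd x \<and> 0 \<le> x \<and> x < int d * int m"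
      using pos by (auto simp: torsion_def m)
    also have "\<dots> \<longleftrightarrow> x \<in> (\<lambda>k. int m * k) ` {0..<int d}"
      using pos by (auto simp: mult.commute[of "int d"] zero_le_mult_iff elim!: dvdE)
    finally show "x \<in> torsion n d \<longleftrightarrow> x \<in> (\<lambda>k. int m * k) ` {0..<int d}" .
  qed
  moreover have "inj_on (\<lambda>k. int m * k) {0..<int d}"
    using pos by (auto intro: inj_onI)
  ultimately show ?thesis by (simp add: card_image)
qed

lemma inj_on_torsion: "n > 0 \<Longrightarrow> inj_on (torsion n) {d. d dvd n}"
  by (rule inj_on_inverseI[where g = card]) (simp add: card_torsion)

text \<open>Dividing both \<open>d * x\<close> and \<open>e * x\<close> means dividing their gcd,
  which is \<open>gcd d e * x\<close> up to sign.\<close>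

lemma torsion_Int: "torsion n d \<inter> torsion n e = torsion n (gcd d e)"
proof -
  have "int n dvd int d * x \<and> int n dvd int e * x \<longleftrightarrow> int n dvd int (gcd d e) * x" for x
  proof -
    have "int n dvd int d * x \<and> int n dvd int e * x \<longleftrightarrow> int n dvd gcd (int d * x) (int e * x)"
      by simp
    also have "gcd (int d * x) (int e * x) = \<bar>int (gcd d e) * x\<bar>"
      by (simp add: gcd_mult_right mult.commute[of x] gcd.commute abs_mult flip: gcd_int_int_eq)
    finally show ?thesis by simp
  qed
  then show ?thesis by (auto simp: torsion_def)
qed

lemma torsion_Int_trivial_iff:
  assumes "n > 0" "d dvd n" "e dvd n"
  shows "torsion n d \<inter> torsion n e = {0} \<longleftrightarrow> coprime d e"
proof -
  have "torsion n (gcd d e) = torsion n 1 \<longleftrightarrow> gcd d e = 1"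
    using assms by (intro inj_on_eq_iff[OF inj_on_torsion]) (auto intro: dvd_trans)
  then show ?thesis
    using torsion_1[OF assms(1)] by (simp add: torsion_Int coprime_iff_gcd_eq_1)
qed

lemma subgroup_torsion:
  assumes "n > 0"
  shows "subgroup (torsion n d) (integer_mod_group n)"
proof (rule group.subgroupI)
  have mod: "int n dvd int d * (a mod int n) \<longleftrightarrow> int n dvd int d * a" for a
    by (simp only: dvd_eq_mod_eq_0 mod_mult_right_eq)
  show "torsion n d \<subseteq> carrier (integer_mod_group n)"
    by (auto simp: torsion_def carrier_integer_mod_group)
  show "torsion n d \<noteq> {}"
    using assms by (auto simp: torsion_def intro!: exI[of _ 0])
  show "inv\<^bsub>integer_mod_group n\<^esub> x \<in> torsion n d" if "x \<in> torsion n d" for x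
  proof -
    have "x \<in> carrier (integer_mod_group n)" "int n dvd int d * - x"
      using that by (auto simp: torsion_def carrier_integer_mod_group)
    then show ?thesis
      using assms mod by (simp add: torsion_def)
  qed
  show "x \<otimes>\<^bsub>integer_mod_group n\<^esub> y \<in> torsion n d" if "x \<in> torsion n d" "y \<in> torsion n d" for x y
  proof -
    have "int n dvd int d * (x + y)"
      using that by (simp add: torsion_def distrib_left)
    then show ?thesis
      using assms mod by (simp add: torsion_def)
  qed
qed simp

lemma order_integer_mod_group: "order (integer_mod_group n) = n"
  by (simp add: order_def carrier_integer_mod_group)

text \<open>By Lagrange, \<open>card H\<close> divides \<open>n\<close> and kills every element of
  \<open>H\<close>. Thus \<open>H\<close> lies in \<open>torsion n (card H)\<close>, a finite set of
  the same cardinality, and equals it.\<close>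

lemma subgroup_integer_mod_group_iff:
  assumes "n > 0"
  shows "subgroup H (integer_mod_group n) \<longleftrightarrow> H \<in> torsion n ` {d. d dvd n}"
proof
  assume H: "subgroup H (integer_mod_group n)"
  interpret G: group "integer_mod_group n" by simp
  interpret H: group "integer_mod_group n\<lparr>carrier := H\<rparr>"
    using H by (simp add: G.subgroup_imp_group)
  have dvd: "card H dvd n"
    using G.lagrange[OF H] by (metis dvd_triv_right order_integer_mod_group)
  have "H \<subseteq> torsion n (card H)"
  proof
    fix x assume x: "x \<in> H"
    \<comment> \<open>The order theorem is applied in \<open>H\<close> as a group of its own; the
      power is \<open>card H * x\<close> modulo \<open>n\<close>.\<close>
    have "x [^]\<^bsub>integer_mod_group n\<^esub> card H = 0"
      using H.pow_order_eq_1[of x] x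
      by (simp add: order_def flip: G.nat_pow_consistent del: pow_integer_mod_group)
    moreover have "x \<in> {0..<int n}"
      using subgroup.subset[OF H] x assms by (auto simp: carrier_integer_mod_group)
    ultimately show "x \<in> torsion n (card H)"
      by (auto simp: torsion_def)
  qed
  then have "H = torsion n (card H)"
    using assms dvd by (intro card_subset_eq finite_torsion) (simp_all add: card_torsion)
  then show "H \<in> torsion n ` {d. d dvd n}" using dvd by blast
qed (use assms in \<open>auto simp: subgroup_torsion\<close>)

lemma nontrivial_proper_subgroups_integer_mod_group:
  assumes "n > 0"
  shows "nontrivial_proper_subgroups (integer_mod_group n)
    = torsion n ` {d. d dvd n \<and> d \<noteq> 1 \<and> d \<noteq> n}"
proof -
  have "torsion n d \<noteq> {0} \<longleftrightarrow> d \<noteq> 1" if "d dvd n" for d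
    using inj_on_eq_iff[OF inj_on_torsion[OF assms], of d 1] that torsion_1[OF assms] by simp
  moreover have "torsion n d \<noteq> {0..<int n} \<longleftrightarrow> d \<noteq> n" if "d dvd n" for d
    using inj_on_eq_iff[OF inj_on_torsion[OF assms], of d n] that torsion_self by simp
  ultimately show ?thesis
    using assms
    by (auto simp: nontrivial_proper_subgroups_def subgroup_integer_mod_group_iff
        carrier_integer_mod_group)
qed

section \<open>Translation of the intersection hypergraph to divisors\<close>

definition vertex_divisors :: "nat \<Rightarrow> nat set"
  where "vertex_divisors n = {d. d dvd n \<and> d \<noteq> 1 \<and> (\<exists>p. prime p \<and> p dvd n \<and> \<not> p dvd d)}"

text \<open>A prime missed by \<open>d\<close> is itself a divisor coprime to \<open>d\<close>;
  conversely, any prime factor of a coprime divisor \<open>e \<noteq> 1\<close> is missed by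
  \<open>d\<close>. Missing a prime of \<open>n\<close> also forces
  \<open>d \<noteq> n\<close>.\<close>

lemma vertex_divisors_eq:
  assumes "n > 0"
  shows "vertex_divisors n
    = {d. d dvd n \<and> d \<noteq> 1 \<and> d \<noteq> n \<and> (\<exists>e. e dvd n \<and> e \<noteq> 1 \<and> e \<noteq> n \<and> coprime d e)}"
proof (intro Set.set_eqI iffI)
  fix d assume d: "d \<in> vertex_divisors n"
  then obtain p where p: "prime p" "p dvd n" "\<not> p dvd d"
    by (auto simp: vertex_divisors_def)
  then have "coprime d p"
    by (metis coprime_commute prime_imp_coprime)
  \<comment> \<open>If \<open>n\<close> were the prime \<open>p\<close>, its divisor
    \<open>d \<noteq> 1\<close> would be \<open>p\<close>, which does not divide
    \<open>d\<close>.\<close>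
  moreover have "p \<noteq> n" "p \<noteq> 1"
    using d p by (auto simp: vertex_divisors_def prime_nat_iff)
  ultimately show "d \<in> {d. d dvd n \<and> d \<noteq> 1 \<and> d \<noteq> n \<and> (\<exists>e. e dvd n \<and> e \<noteq> 1 \<and> e \<noteq> n \<and> coprime d e)}"
    using d p by (auto simp: vertex_divisors_def)
next
  fix d assume "d \<in> {d. d dvd n \<and> d \<noteq> 1 \<and> d \<noteq> n \<and> (\<exists>e. e dvd n \<and> e \<noteq> 1 \<and> e \<noteq> n \<and> coprime d e)}"
  then obtain e where d: "d dvd n" "d \<noteq> 1" and e: "e dvd n" "e \<noteq> 1" "coprime d e"
    by blast
  from \<open>e \<noteq> 1\<close> obtain p where "prime p" "p dvd e"
    using prime_factor_nat by blast
  moreover from this have "\<not> p dvd d"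
    using coprime_common_divisor[of d e p] e(3) not_prime_unit[of p] by blast
  ultimately show "d \<in> vertex_divisors n"
    using d e(1) dvd_trans[of p e n] by (auto simp: vertex_divisors_def)
qed

lemma intersection_vertices_integer_mod_group:
  assumes "n > 0"
  shows "intersection_vertices (integer_mod_group n) = torsion n ` vertex_divisors n"
proof -
  let ?A = "{d. d dvd n \<and> d \<noteq> 1 \<and> d \<noteq> n}"
  have "intersection_vertices (integer_mod_group n)
      = torsion n ` {d \<in> ?A. \<exists>e \<in> ?A. torsion n d \<inter> torsion n e = {0}}"
    unfolding intersection_vertices_def nontrivial_proper_subgroups_integer_mod_group[OF assms]
      one_integer_mod_group by blast
  also have "{d \<in> ?A. \<exists>e \<in> ?A. torsion n d \<inter> torsion n e = {0}} = vertex_divisors n"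
    unfolding vertex_divisors_eq[OF assms] using torsion_Int_trivial_iff[OF assms]
    by (intro Collect_cong) blast
  finally show ?thesis .
qed

lemma trivially_intersecting_torsion:
  assumes "n > 0" "D \<subseteq> {d. d dvd n}"
  shows "trivially_intersecting (integer_mod_group n) (torsion n ` D) \<longleftrightarrow> pairwise coprime D"
proof -
  have "torsion n d = torsion n e \<longleftrightarrow> d = e" "torsion n d \<inter> torsion n e = {0} \<longleftrightarrow> coprime d e"
    if "d \<in> D" "e \<in> D" for d e
    using that assms inj_on_eq_iff[OF inj_on_torsion[OF assms(1)], of d e]
      torsion_Int_trivial_iff[OF assms(1), of d e] by auto
  then show ?thesis
    by (simp add: trivially_intersecting_def pairwise_def)
qed

text \<open>Maximality is replaced by the condition that every prime divisor of \<open>n\<close> is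
  covered; \<open>maximal_coprime_iff\<close> shows the equivalence.\<close>

definition divisor_hypergraph :: "nat \<Rightarrow> nat hypergraph"
  where "divisor_hypergraph n = (vertex_divisors n,
    {D. D \<subseteq> vertex_divisors n \<and> pairwise coprime D \<and>
      (\<forall>p. prime p \<longrightarrow> p dvd n \<longrightarrow> (\<exists>d \<in> D. p dvd d))})"

text \<open>An uncovered prime can be added to \<open>D\<close> as a new vertex. If all primes are
  covered, a new vertex shares a prime factor with some member of \<open>D\<close>, so nothing can
  be added.\<close>

lemma maximal_coprime_iff:
  assumes n: "card (prime_factors n) \<ge> 2"
    and D: "D \<subseteq> vertex_divisors n" "pairwise coprime D"
  shows "\<not> (\<exists>D' \<subseteq> vertex_divisors n. D \<subset> D' \<and> pairwise coprime D')
    \<longleftrightarrow> (\<forall>p. prime p \<longrightarrow> p dvd n \<longrightarrow> (\<exists>d \<in> D. p dvd d))"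
proof
  assume max: "\<not> (\<exists>D' \<subseteq> vertex_divisors n. D \<subset> D' \<and> pairwise coprime D')"
  show "\<forall>p. prime p \<longrightarrow> p dvd n \<longrightarrow> (\<exists>d \<in> D. p dvd d)"
  proof (intro allI impI, rule ccontr)
    fix p assume p: "prime p" "p dvd n" "\<not> (\<exists>d \<in> D. p dvd d)"
    \<comment> \<open>A second prime divisor \<open>q\<close> is what \<open>p\<close> misses, which
      makes \<open>p\<close> a vertex.\<close>
    have "\<not> prime_factors n \<subseteq> {p}"
      using n card_mono[of "{p}" "prime_factors n"] by auto
    then obtain q where "prime q" "q dvd n" "q \<noteq> p"
      by (auto simp: prime_factors_dvd)
    moreover from this p(1) have "\<not> q dvd p" using primes_dvd_imp_eq by blast
    ultimately have "p \<in> vertex_divisors n"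
      using p by (auto simp: vertex_divisors_def)
    moreover have "pairwise coprime (insert p D)"
      using D(2) prime_imp_coprime[OF p(1)] p(3) coprime_commute unfolding pairwise_insert by blast
    moreover have "D \<subset> insert p D" using p(3) by force
    ultimately show False using max D by (metis insert_subset)
  qed
next
  assume cover: "\<forall>p. prime p \<longrightarrow> p dvd n \<longrightarrow> (\<exists>d \<in> D. p dvd d)"
  show "\<not> (\<exists>D' \<subseteq> vertex_divisors n. D \<subset> D' \<and> pairwise coprime D')"
  proof
    assume "\<exists>D' \<subseteq> vertex_divisors n. D \<subset> D' \<and> pairwise coprime D'"
    then obtain D' x where D': "D' \<subseteq> vertex_divisors n" "pairwise coprime D'" "D \<subset> D'"
      and x: "x \<in> D'" "x \<notin> D" by blast
    then obtain p where p: "prime p" "p dvd x"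
      using prime_factor_nat[of x] by (auto simp: vertex_divisors_def)
    moreover have "x dvd n" using x D' by (auto simp: vertex_divisors_def)
    ultimately obtain d where "d \<in> D" "p dvd d" using cover dvd_trans by blast
    moreover have "coprime x d"
      using calculation D' x by (metis pairwiseD psubsetD)
    ultimately show False
      using p coprime_common_divisor[of x d p] not_prime_unit[of p] by blast
  qed
qed

text \<open>On sets of vertex divisors, taking images under \<open>torsion n\<close> preserves and
  reflects strict inclusion and turns coprimality into trivial intersection, so maximal families
  correspond.\<close>

lemma intersection_hypergraph_integer_mod_group:
  assumes "n > 0" "card (prime_factors n) \<ge> 2"
  shows "intersection_hypergraph (integer_mod_group n) =
    (torsion n ` fst (divisor_hypergraph n), (`) (torsion n) ` snd (divisor_hypergraph n))"
proof -
  let ?G = "integer_mod_group n" and ?V = "vertex_divisors n"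
  have V: "?V \<subseteq> {d. d dvd n}" by (auto simp: vertex_divisors_def)
  have inj: "inj_on (torsion n) ?V"
    using inj_on_subset[OF inj_on_torsion[OF assms(1)] V] .
  have triv: "trivially_intersecting ?G (torsion n ` D) \<longleftrightarrow> pairwise coprime D" if "D \<subseteq> ?V" for D
    using trivially_intersecting_torsion[OF assms(1)] that V by blast
  have sub: "torsion n ` D \<subseteq> torsion n ` D' \<longleftrightarrow> D \<subseteq> D'" if "D \<subseteq> ?V" "D' \<subseteq> ?V" for D D'
    using that inj unfolding inj_on_def by blast
  have strict: "torsion n ` D \<subset> torsion n ` D' \<longleftrightarrow> D \<subset> D'" if "D \<subseteq> ?V" "D' \<subseteq> ?V" for D D'
    using sub[OF that] sub[OF that(2,1)] by (simp only: less_le_not_le)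
  have max: "(\<exists>E'. E' \<subseteq> torsion n ` ?V \<and> torsion n ` D \<subset> E' \<and> trivially_intersecting ?G E')
      \<longleftrightarrow> (\<exists>D' \<subseteq> ?V. D \<subset> D' \<and> pairwise coprime D')" (is "?A \<longleftrightarrow> ?B") if "D \<subseteq> ?V" for D
  proof -
    \<comment> \<open>Every competing \<open>E'\<close> is the image of some
      \<open>D' \<subseteq> ?V\<close>, so only such images need to be considered.\<close>
    have "?A \<longleftrightarrow> (\<exists>D' \<subseteq> ?V. torsion n ` D \<subset> torsion n ` D' \<and>
        trivially_intersecting ?G (torsion n ` D'))"
      by (metis (no_types, lifting) image_mono subset_imageE)
    also have "\<dots> \<longleftrightarrow> ?B"
      by (intro ex_cong1 conj_cong refl) (simp_all add: triv strict that)
    finally show ?thesis .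
  qed
  have "{E. E \<subseteq> torsion n ` ?V \<and> trivially_intersecting ?G E \<and>
       \<not> (\<exists>E'. E' \<subseteq> torsion n ` ?V \<and> E \<subset> E' \<and> trivially_intersecting ?G E')}
    = (`) (torsion n) ` {D. D \<subseteq> ?V \<and> pairwise coprime D \<and>
        \<not> (\<exists>D' \<subseteq> ?V. D \<subset> D' \<and> pairwise coprime D')}" (is "?L = ?R")
  proof
    show "?L \<subseteq> ?R"
    proof
      fix E assume E: "E \<in> ?L"
      then obtain D where D: "E = torsion n ` D" "D \<subseteq> ?V" by (auto simp: subset_image_iff)
      have "D \<in> {D. D \<subseteq> ?V \<and> pairwise coprime D \<and>
        \<not> (\<exists>D' \<subseteq> ?V. D \<subset> D' \<and> pairwise coprime D')}"
        using E D(2) unfolding D(1) mem_Collect_eq max[OF D(2)] triv[OF D(2)] by (elim conjE, intro conjI)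
      then show "E \<in> ?R" unfolding D(1) by (rule imageI)
    qed
    show "?R \<subseteq> ?L"
    proof
      fix E assume "E \<in> ?R"
      then obtain D where D: "E = torsion n ` D" "D \<subseteq> ?V" "pairwise coprime D"
        "\<not> (\<exists>D' \<subseteq> ?V. D \<subset> D' \<and> pairwise coprime D')" by (elim imageE CollectE conjE)
      show "E \<in> ?L"
        unfolding D(1) mem_Collect_eq max[OF D(2)] triv[OF D(2)]
        using D(2-4) by (intro conjI image_mono)
    qed
  qed
  moreover have "{D. D \<subseteq> ?V \<and> pairwise coprime D \<and>
        \<not> (\<exists>D' \<subseteq> ?V. D \<subset> D' \<and> pairwise coprime D')} = snd (divisor_hypergraph n)"
    using maximal_coprime_iff[OF assms(2)] by (auto simp: divisor_hypergraph_def)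
  ultimately show ?thesis
    by (simp add: intersection_hypergraph_def intersection_vertices_integer_mod_group[OF assms(1)]
        divisor_hypergraph_def)
qed

subsection \<open>The hypergraph of divisors\<close>

lemma divisor_hyperedgeD:
  assumes "D \<in> snd (divisor_hypergraph n)"
  shows "x \<in> D \<Longrightarrow> x \<in> vertex_divisors n"
    "x \<in> D \<Longrightarrow> y \<in> D \<Longrightarrow> x \<noteq> y \<Longrightarrow> coprime x y"
    "prime p \<Longrightarrow> p dvd n \<Longrightarrow> \<exists>x \<in> D. p dvd x"
  using assms by (auto simp: divisor_hypergraph_def pairwise_def)

text \<open>Together with the covering condition, each prime divisor of \<open>n\<close> divides
  exactly one member of a hyperedge.\<close>

lemma divisor_hyperedge_common_prime:
  assumes "D \<in> snd (divisor_hypergraph n)" "x \<in> D" "y \<in> D" "prime p" "p dvd x" "p dvd y"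
  shows "x = y"
  using divisor_hyperedgeD(2)[OF assms(1-3)] assms(4-6) coprime_common_divisor[of x y p]
    not_prime_unit[of p] by blast

section \<open>Two prime divisors\<close>

lemma not_dvd_prime_power:
  fixes p q :: nat
  assumes "prime p" "prime q" "p \<noteq> q"
  shows "\<not> q dvd p ^ i"
  using assms prime_dvd_power primes_dvd_imp_eq by blast

lemma vertex_divisors_two_primes:
  fixes p q :: nat
  assumes "prime p" "prime q" "p \<noteq> q" "a \<ge> 1" "b \<ge> 1"
  shows "vertex_divisors (p ^ a * q ^ b) = (\<lambda>i. p ^ i) ` {1..a} \<union> (\<lambda>j. q ^ j) ` {1..b}"
proof (intro equalityI subsetI)
  \<comment> \<open>The variables are bound afresh so that the fact serves for both orders of the
    two primes.\<close>
  have power: "d \<in> (\<lambda>i. p ^ i) ` {1..a}"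
    if dvd: "d dvd p ^ a * q ^ b" "d \<noteq> 1" "\<not> q dvd d" and p: "prime p" and "prime q" for p q d a b :: nat
  proof -
    have "coprime d (q ^ b)"
      using that prime_imp_coprime[of q d] by (simp add: coprime_commute)
    then have "d dvd p ^ a"
      using dvd(1) by (simp add: coprime_dvd_mult_left_iff)
    then obtain i where "i \<le> a" "d = p ^ i"
      using divides_primepow_nat[OF p] by blast
    with \<open>d \<noteq> 1\<close> show ?thesis by (cases "i = 0") auto
  qed
  fix d assume "d \<in> vertex_divisors (p ^ a * q ^ b)"
  then obtain r where d: "d dvd p ^ a * q ^ b" "d \<noteq> 1"
    and r: "prime r" "r dvd p ^ a * q ^ b" "\<not> r dvd d"
    by (auto simp: vertex_divisors_def)
  then have "r = p \<or> r = q"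
    using assms by (metis prime_dvd_mult_iff prime_dvd_power primes_dvd_imp_eq)
  then show "d \<in> (\<lambda>i. p ^ i) ` {1..a} \<union> (\<lambda>j. q ^ j) ` {1..b}"
    using power[of d p a q b] power[of d q b p a] d r(3) assms(1,2) by (auto simp: mult.commute)
next
  have vertex: "p ^ i \<in> vertex_divisors (p ^ a * q ^ b)"
    if "i \<in> {1..a}" "1 \<le> b" "prime p" "prime q" "p \<noteq> q" for p q a b i :: nat
    using that not_dvd_prime_power[of p q i]
    by (auto simp: vertex_divisors_def le_imp_power_dvd prime_gt_1_nat less_imp_neq[symmetric]
        intro!: exI[of _ q] dvd_mult2 dvd_mult dvd_power)
  fix d assume "d \<in> (\<lambda>i. p ^ i) ` {1..a} \<union> (\<lambda>j. q ^ j) ` {1..b}"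
  then show "d \<in> vertex_divisors (p ^ a * q ^ b)"
    using vertex[of _ a b p q] vertex[of _ b a q p] assms by (auto simp: mult.commute)
qed

text \<open>Every vertex is a power of \<open>p\<close> or of \<open>q\<close>, and each of the two
  primes divides exactly one member.\<close>

lemma divisor_hyperedges_two_primes:
  fixes p q :: nat
  assumes pq: "prime p" "prime q" "p \<noteq> q" "a \<ge> 1" "b \<ge> 1"
  shows "D \<in> snd (divisor_hypergraph (p ^ a * q ^ b))
    \<longleftrightarrow> (\<exists>i \<in> {1..a}. \<exists>j \<in> {1..b}. D = {p ^ i, q ^ j})"
proof
  note V = vertex_divisors_two_primes[OF pq]
  assume D: "D \<in> snd (divisor_hypergraph (p ^ a * q ^ b))"
  have "p dvd p ^ a * q ^ b" "q dvd p ^ a * q ^ b"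
    using pq by (simp_all add: dvd_power)
  then obtain x y where x: "x \<in> D" "p dvd x" and y: "y \<in> D" "q dvd y"
    using divisor_hyperedgeD(3)[OF D] pq(1,2) by metis
  have dvd: "p dvd z \<or> q dvd z" if "z \<in> D" for z
    using divisor_hyperedgeD(1)[OF D that] unfolding V by (auto simp: dvd_power)
  have "D = {x, y}"
    using dvd x y divisor_hyperedge_common_prime[OF D] pq(1,2) by blast
  moreover obtain i where "i \<in> {1..a}" "x = p ^ i"
    using divisor_hyperedgeD(1)[OF D x(1)] x(2) not_dvd_prime_power[of q p] pq unfolding V by auto
  moreover obtain j where "j \<in> {1..b}" "y = q ^ j"
    using divisor_hyperedgeD(1)[OF D y(1)] y(2) not_dvd_prime_power[of p q] pq unfolding V by auto
  ultimately show "\<exists>i \<in> {1..a}. \<exists>j \<in> {1..b}. D = {p ^ i, q ^ j}" by blast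
next
  note V = vertex_divisors_two_primes[OF pq]
  assume "\<exists>i \<in> {1..a}. \<exists>j \<in> {1..b}. D = {p ^ i, q ^ j}"
  then obtain i j where D: "D = {p ^ i, q ^ j}" and ij: "i \<in> {1..a}" "j \<in> {1..b}" by blast
  have "coprime (p ^ i) (q ^ j)"
    using pq by (simp add: primes_coprime)
  moreover have "r = p \<or> r = q" if "prime r" "r dvd p ^ a * q ^ b" for r
    using that pq by (metis prime_dvd_mult_iff prime_dvd_power primes_dvd_imp_eq)
  moreover have "p dvd p ^ i" "q dvd q ^ j" using ij by (auto intro: dvd_power)
  moreover from calculation(2-4) have "r dvd p ^ i \<or> r dvd q ^ j"
    if "prime r" "r dvd p ^ a * q ^ b" for r
    using that by blast
  ultimately show "D \<in> snd (divisor_hypergraph (p ^ a * q ^ b))"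
    using ij by (auto simp: divisor_hypergraph_def V D pairwise_insert coprime_commute)
qed

text \<open>The hyperedges are the edges \<open>{p ^ i, q}\<close> of a star, so two distinct ones
  share only the centre \<open>q\<close>.\<close>

lemma girth_divisor_hypergraph_two_primes_infinity:
  fixes p q :: nat
  assumes pq: "prime p" "prime q" "p \<noteq> q" "a \<ge> 1"
  shows "girth (divisor_hypergraph (p ^ a * q)) = \<infinity>"
proof (rule girth_infinityI_two_edges)
  let ?\<Gamma> = "divisor_hypergraph (p ^ a * q)"
  have edge: "\<exists>i. D = {p ^ i, q}" if "D \<in> snd ?\<Gamma>" for D
    using divisor_hyperedges_two_primes[OF pq, of 1 D] that by auto
  have center: "x = q" if "D \<in> snd ?\<Gamma>" "D' \<in> snd ?\<Gamma>" "D \<noteq> D'" "x \<in> D" "x \<in> D'" for x D D'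
    using edge[OF that(1)] edge[OF that(2)] that(3-5) by auto
  fix e e' u v u' v'
  assume neq: "u \<noteq> v"
    and B: "{u, v, u', v'} \<subseteq> {x. \<exists>e \<in> snd ?\<Gamma>. \<exists>e' \<in> snd ?\<Gamma>. e \<noteq> e' \<and> x \<in> e \<and> x \<in> e'}"
  from B have "u = q" "v = q" using center by blast+
  with neq show "e = e'" by blast
qed

text \<open>The 4-cycle is \<open>p, q, p^2, q^2\<close>, available because both exponents are at
  least 2; divisibility by \<open>p\<close> gives the bipartition.\<close>

lemma girth_divisor_hypergraph_two_primes_4:
  fixes p q :: nat
  assumes pq: "prime p" "prime q" "p \<noteq> q" and ab: "a \<ge> 2" "b \<ge> 2"
  shows "girth (divisor_hypergraph (p ^ a * q ^ b)) = 4"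
proof -
  let ?\<Gamma> = "divisor_hypergraph (p ^ a * q ^ b)"
  note edges = divisor_hyperedges_two_primes[OF pq, of a b]
  have edge: "{p ^ i, q ^ j} \<in> snd ?\<Gamma>" if "i \<in> {1, 2}" "j \<in> {1, 2}" for i j
    using edges[of "{p ^ i, q ^ j}"] ab that by fastforce
  have vertex: "{p ^ 1, q ^ 1, p ^ 2, q ^ 2} \<subseteq> fst ?\<Gamma>"
    using edge[of 1 1] edge[of 2 2] by (simp add: divisor_hypergraph_def)
  have "p ^ i \<noteq> q ^ j" if "j > 0" for i j
    using not_dvd_prime_power[OF pq, of i] that by (metis dvd_power)
  moreover have "p > 1" "q > 1" using pq prime_gt_1_nat by auto
  ultimately have dist: "distinct [p ^ 1, q ^ 1, p ^ 2, q ^ 2]"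
    using power_inject_exp[of p 1 2] power_inject_exp[of q 1 2]
    by (simp del: power_inject_exp) (metis power_one_right zero_less_numeral zero_less_one)
  show ?thesis
  proof (rule girth_eq_4I[OF dist vertex, where X = "{x. p dvd x}"])
    show "{p ^ 1, q ^ 1} \<in> snd ?\<Gamma>" "{q ^ 1, p ^ 2} \<in> snd ?\<Gamma>"
      "{p ^ 2, q ^ 2} \<in> snd ?\<Gamma>" "{q ^ 2, p ^ 1} \<in> snd ?\<Gamma>"
      using edge[of 1 1] edge[of 2 1] edge[of 2 2] edge[of 1 2] by (simp_all add: insert_commute)
    fix D assume "D \<in> snd ?\<Gamma>"
    then obtain i j where "i \<in> {1..a}" "D = {p ^ i, q ^ j}"
      using edges[of D] ab by auto
    then show "\<exists>x y. D = {x, y} \<and> x \<in> {x. p dvd x} \<and> y \<notin> {x. p dvd x}"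
      using not_dvd_prime_power[of q p j] pq
      by (intro exI[of _ "p ^ i"] exI[of _ "q ^ j"] conjI) (auto intro: dvd_power)
  qed
qed

section \<open>Products of three primes\<close>

lemma dvd_three_primes_eq:
  fixes p q r x :: nat
  assumes "prime p" "prime q" "prime r" "x dvd p * q * r" "x \<noteq> 1" "\<not> q dvd x" "\<not> r dvd x"
  shows "x = p"
proof -
  \<comment> \<open>Coprimality to \<open>q\<close> and \<open>r\<close> cancels both factors from
    the product.\<close>
  have "coprime x r" "coprime x q"
    using assms by (simp_all add: coprime_commute prime_imp_coprime)
  then have "x dvd p"
    using assms(4) by (simp add: coprime_dvd_mult_left_iff)
  then show ?thesis using assms(1,5) prime_nat_iff by blast
qed

text \<open>The prime missed by \<open>x\<close> can only be \<open>r\<close>, so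
  \<open>x = p * q\<close>. The other members avoid \<open>p\<close> and \<open>q\<close>, which
  leaves only \<open>r\<close>.\<close>

lemma divisor_hyperedge_three_primes_product:
  fixes p q r :: nat
  assumes pqr: "prime p" "prime q" "prime r" "p \<noteq> q" and n: "n = p * q * r"
    and D: "D \<in> snd (divisor_hypergraph n)" and x: "x \<in> D" "p dvd x" "q dvd x"
  shows "D = {p * q, r}"
proof -
  have V: "z dvd p * q * r" "z \<noteq> 1" if "z \<in> D" for z
    using divisor_hyperedgeD(1)[OF D that] by (auto simp: vertex_divisors_def n)
  note common = divisor_hyperedge_common_prime[OF D]
  have only_r: "z = r" if "z \<in> D" "z \<noteq> x" for z
    using dvd_three_primes_eq[of r p q z] V[OF that(1)] common[OF that(1) x(1)] x pqr that
    by (auto simp: ac_simps)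
  have "\<exists>s. prime s \<and> s dvd p * q * r \<and> \<not> s dvd x"
    using divisor_hyperedgeD(1)[OF D x(1)] by (auto simp: vertex_divisors_def n)
  then have "\<not> r dvd x"
    using x pqr by (metis prime_dvd_mult_iff primes_dvd_imp_eq)
  moreover obtain y where "y \<in> D" "r dvd y"
    using divisor_hyperedgeD(3)[OF D pqr(3)] n by auto
  ultimately have "r \<in> D" using only_r by metis
  moreover have "x = p * q"
  proof (rule dvd_antisym)
    have "coprime x r"
      using \<open>\<not> r dvd x\<close> pqr by (simp add: coprime_commute prime_imp_coprime)
    then show "x dvd p * q" using V(1)[OF x(1)] by (simp add: coprime_dvd_mult_left_iff)
    show "p * q dvd x" using x pqr by (simp add: divides_mult primes_coprime)
  qed
  ultimately show ?thesis using only_r x(1) by auto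
qed

text \<open>The members \<open>p\<close> and \<open>q\<close> use up these two primes, so any
  further member is \<open>r\<close>, and covering \<open>r\<close> requires one.\<close>

lemma divisor_hyperedge_three_primes:
  fixes p q r :: nat
  assumes pqr: "prime p" "prime q" "prime r" "p \<noteq> q" "p \<noteq> r" "q \<noteq> r" and n: "n = p * q * r"
    and D: "D \<in> snd (divisor_hypergraph n)" and mem: "p \<in> D" "q \<in> D"
  shows "D = {p, q, r}"
proof -
  note common = divisor_hyperedge_common_prime[OF D]
  have only_r: "z = r" if "z \<in> D" "z \<noteq> p" "z \<noteq> q" for z
  proof -
    have "z dvd p * q * r" "z \<noteq> 1"
      using divisor_hyperedgeD(1)[OF D that(1)] by (auto simp: vertex_divisors_def n)
    moreover have "\<not> p dvd z" "\<not> q dvd z"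
      using common[OF that(1) mem(1) pqr(1)] common[OF that(1) mem(2) pqr(2)] that(2,3) by auto
    ultimately show ?thesis
      using dvd_three_primes_eq[of r p q z] pqr by (simp add: ac_simps)
  qed
  obtain y where y: "y \<in> D" "r dvd y"
    using divisor_hyperedgeD(3)[OF D pqr(3)] n by auto
  then have "y \<noteq> p" "y \<noteq> q"
    using pqr primes_dvd_imp_eq by blast+
  then have "r \<in> D" using only_r y(1) by metis
  then show ?thesis using only_r mem by auto
qed

text \<open>A vertex divisible by two of the primes determines its hyperedge, so vertices in several
  hyperedges are prime. Two of the primes in a common hyperedge determine it as well.\<close>

lemma girth_divisor_hypergraph_three_primes:
  fixes p q r :: nat
  assumes pqr: "prime p" "prime q" "prime r" "p \<noteq> q" "p \<noteq> r" "q \<noteq> r"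
  shows "girth (divisor_hypergraph (p * q * r)) = \<infinity>"
proof (rule girth_infinityI_two_edges)
  let ?n = "p * q * r"
  let ?\<Gamma> = "divisor_hypergraph ?n"
  \<comment> \<open>The rearrangements let each prime take the last place in the two preceding
    lemmas.\<close>
  have perm: "?n = p * q * r" "?n = p * r * q" "?n = q * r * p" by simp_all
  have deg: "x \<in> {p, q, r}"
    if "D \<in> snd ?\<Gamma>" "D' \<in> snd ?\<Gamma>" "D \<noteq> D'" "x \<in> D" "x \<in> D'" for x D D'
  proof -
    note prod = divisor_hyperedge_three_primes_product
    have "\<not> (p dvd x \<and> q dvd x)" "\<not> (p dvd x \<and> r dvd x)" "\<not> (q dvd x \<and> r dvd x)"
      using prod[OF pqr(1,2,3,4) perm(1) that(1) that(4)] prod[OF pqr(1,2,3,4) perm(1) that(2) that(5)]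
        prod[OF pqr(1,3,2,5) perm(2) that(1) that(4)] prod[OF pqr(1,3,2,5) perm(2) that(2) that(5)]
        prod[OF pqr(2,3,1,6) perm(3) that(1) that(4)] prod[OF pqr(2,3,1,6) perm(3) that(2) that(5)]
        that(3) by blast+
    moreover have "x dvd p * q * r" "x dvd q * p * r" "x dvd r * p * q" "x \<noteq> 1"
      using divisor_hyperedgeD(1)[OF that(1,4)] by (auto simp: vertex_divisors_def ac_simps)
    ultimately show ?thesis
      using dvd_three_primes_eq[of p q r x] dvd_three_primes_eq[of q p r x]
        dvd_three_primes_eq[of r p q x] pqr(1-3) by blast
  qed
  have two: "D = {p, q, r}" if "D \<in> snd ?\<Gamma>" "{u, v} \<subseteq> D" "u \<noteq> v" "{u, v} \<subseteq> {p, q, r}" for D u v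
  proof -
    note three = divisor_hyperedge_three_primes
    have "p \<in> D \<and> q \<in> D \<or> p \<in> D \<and> r \<in> D \<or> q \<in> D \<and> r \<in> D" using that by auto
    then show ?thesis
      using three[OF pqr perm(1) that(1)]
        three[OF pqr(1,3,2,5,4) pqr(6)[symmetric] perm(2) that(1)]
        three[OF pqr(2,3,1,6) pqr(4,5)[symmetric] perm(3) that(1)] by blast
  qed
  fix e e' u v u' v'
  assume "e \<in> snd ?\<Gamma>" "e' \<in> snd ?\<Gamma>" "{u, v} \<subseteq> e" "{u', v'} \<subseteq> e'" "u \<noteq> v" "u' \<noteq> v'"
    and B: "{u, v, u', v'} \<subseteq> {x. \<exists>e \<in> snd ?\<Gamma>. \<exists>e' \<in> snd ?\<Gamma>. e \<noteq> e' \<and> x \<in> e \<and> x \<in> e'}"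
  moreover have "{u, v} \<subseteq> {p, q, r}" "{u', v'} \<subseteq> {p, q, r}"
    using B deg by blast+
  ultimately show "e = e'" using two[of e u v] two[of e' u' v'] by blast
qed

section \<open>The remaining cases, with girth 2\<close>

lemma insert_primes_hyperedge:
  fixes m n q :: nat
  assumes m: "m dvd n" "m \<noteq> 1" and q: "prime q" "q dvd n" "\<not> q dvd m"
  shows "insert m {p. prime p \<and> p dvd n \<and> \<not> p dvd m} \<in> snd (divisor_hypergraph n)"
proof -
  \<comment> \<open>The prime \<open>s\<close> is missed by every added prime \<open>p\<close>,
    since \<open>p\<close> does not divide \<open>m\<close>; this makes \<open>p\<close> a
    vertex.\<close>
  obtain s where s: "prime s" "s dvd m" using m(2) prime_factor_nat by blast
  have "p \<in> vertex_divisors n" if "prime p" "p dvd n" "\<not> p dvd m" for p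
    using that s m(1) primes_dvd_imp_eq[of s p]
    by (auto simp: vertex_divisors_def intro!: exI[of _ s] intro: dvd_trans)
  moreover have "m \<in> vertex_divisors n"
    using m q by (auto simp: vertex_divisors_def)
  moreover have "pairwise coprime (insert m {p. prime p \<and> p dvd n \<and> \<not> p dvd m})"
    using prime_imp_coprime[of _ m] primes_coprime
    by (auto simp: pairwise_def coprime_commute[of m])
  ultimately show ?thesis
    by (auto simp: divisor_hypergraph_def)
qed

text \<open>The completions of \<open>r\<close> and of \<open>r * s\<close> by the primes they miss
  both contain \<open>p\<close> and \<open>q\<close>.\<close>

lemma girth_divisor_hypergraph_2:
  fixes n p q r s :: nat
  assumes pq: "prime p" "prime q" "p dvd n" "q dvd n" "p \<noteq> q"
    and rs: "prime r" "prime s" "r * s dvd n" "p \<notin> {r, s}" "q \<notin> {r, s}"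
  shows "girth (divisor_hypergraph n) = 2"
proof (rule girth_eq_2I)
  let ?E = "\<lambda>m. insert m {p. prime p \<and> p dvd n \<and> \<not> p dvd m}"
  have ndvd: "\<not> p dvd r" "\<not> q dvd r" "\<not> p dvd r * s" "\<not> q dvd r * s"
    using pq(1,2) rs by (auto simp: prime_dvd_mult_iff dest: primes_dvd_imp_eq)
  have gt: "r > 1" "s > 1" using rs(1,2) prime_gt_1_nat by auto
  then have r: "r \<noteq> 1" "r * s \<noteq> 1" "r * s \<noteq> r" by auto
  have "r dvd n" using rs(3) by (rule dvd_mult_left)
  have "\<not> prime (r * s)" using prime_product[of r s] gt by auto
  show E: "?E r \<in> snd (divisor_hypergraph n)" "?E (r * s) \<in> snd (divisor_hypergraph n)"
    using insert_primes_hyperedge[OF \<open>r dvd n\<close> r(1) pq(1,3) ndvd(1)]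
      insert_primes_hyperedge[OF rs(3) r(2) pq(1,3) ndvd(3)] .
  \<comment> \<open>The number \<open>r * s\<close> lies in the second set but not in the first,
    being neither \<open>r\<close> nor prime.\<close>
  show "?E r \<noteq> ?E (r * s)" using r(3) \<open>\<not> prime (r * s)\<close> by blast
  show "p \<noteq> q" "{p, q} \<subseteq> ?E r \<inter> ?E (r * s)" using pq ndvd by auto
  then show "{p, q} \<subseteq> fst (divisor_hypergraph n)"
    using E(1) by (auto simp: divisor_hypergraph_def)
qed

lemma card_ge_2_obtains:
  assumes "card A \<ge> 2"
  obtains x y where "x \<in> A" "y \<in> A" "x \<noteq> y"
  using obtain_subset_with_card_n[OF assms] by (metis card_2_iff insert_subset)

text \<open>If the square of a prime \<open>r\<close> divides \<open>n\<close>, then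
  \<open>s = r\<close> leaves two further primes. Otherwise \<open>n\<close> is squarefree and not a
  product of three primes, so it has at least four, and two distinct ones serve as \<open>r\<close>
  and \<open>s\<close>.\<close>

lemma girth_divisor_hypergraph_otherwise:
  fixes n :: nat
  assumes n: "n > 0" "card (prime_factors n) \<ge> 3"
    and not_prod: "\<And>p q r. \<lbrakk>prime p; prime q; prime r; p \<noteq> q; p \<noteq> r; q \<noteq> r\<rbrakk> \<Longrightarrow> n \<noteq> p * q * r"
  shows "girth (divisor_hypergraph n) = 2"
proof -
  have P: "prime p" "p dvd n" if "p \<in> prime_factors n" for p
    using that by (auto simp: prime_factors_dvd)
  have "\<exists>r \<in> prime_factors n. \<exists>s \<in> prime_factors n. r * s dvd n \<and> card (prime_factors n - {r, s}) \<ge> 2"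
  proof (cases "\<exists>r \<in> prime_factors n. r * r dvd n")
    case True
    then obtain r where "r \<in> prime_factors n" "r * r dvd n" by blast
    moreover have "card (prime_factors n - {r}) \<ge> 2"
      using n(2) \<open>r \<in> prime_factors n\<close> by simp
    ultimately show ?thesis by (metis insert_absorb2)
  next
    case False
    have mult: "multiplicity p n = 1" if "p \<in> prime_factors n" for p
    proof -
      have "\<not> 2 \<le> multiplicity p n"
        using False that multiplicity_dvd'[of 2 p n] by (auto simp: power2_eq_square)
      moreover have "multiplicity p n \<noteq> 0"
        using P[OF that] n(1) by (simp add: prime_multiplicity_gt_zero_iff)
      ultimately show ?thesis by simp
    qed
    have "card (prime_factors n) \<noteq> 3"
    proof
      assume "card (prime_factors n) = 3"
      then obtain p q r where pqr: "prime_factors n = {p, q, r}" "p \<noteq> q" "p \<noteq> r" "q \<noteq> r"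
        by (auto simp: card_3_iff)
      have "n = (\<Prod>p \<in> prime_factors n. p)"
        using prime_factorization_nat[OF n(1)] mult by simp
      then have "n = p * q * r" using pqr by (simp add: mult.assoc)
      then show False using not_prod[of p q r] P pqr by simp
    qed
    then have "card (prime_factors n) \<ge> 4" using n(2) by simp
    moreover from this obtain r s where rs: "r \<in> prime_factors n" "s \<in> prime_factors n" "r \<noteq> s"
      using card_ge_2_obtains[of "prime_factors n"] by auto
    ultimately have "card (prime_factors n - {r, s}) \<ge> 2"
      by (simp add: card_Diff_subset)
    moreover have "r * s dvd n"
      using rs P by (simp add: divides_mult primes_coprime)
    ultimately show ?thesis using rs by blast
  qed
  then obtain r s where rs: "r \<in> prime_factors n" "s \<in> prime_factors n" "r * s dvd n"
    and "card (prime_factors n - {r, s}) \<ge> 2" by blast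
  then obtain p q where "p \<in> prime_factors n - {r, s}" "q \<in> prime_factors n - {r, s}" "p \<noteq> q"
    using card_ge_2_obtains by metis
  then show ?thesis
    using girth_divisor_hypergraph_2[of p q n r s] P rs by auto
qed

section \<open>Assembling the cases\<close>

lemma card_prime_factors_2_cases:
  fixes n :: nat
  assumes n: "n > 0" "card (prime_factors n) = 2"
  obtains p q a b where "prime p" "prime q" "p \<noteq> q" "a \<ge> 1" "b \<ge> 1" "n = p ^ a * q ^ b"
proof -
  obtain p q where pq: "prime_factors n = {p, q}" "p \<noteq> q"
    using n(2) by (auto simp: card_2_iff)
  then have "prime p" "prime q" "p dvd n" "q dvd n"
    by (auto simp: prime_factors_dvd set_eq_iff)
  moreover from this have "multiplicity p n \<ge> 1" "multiplicity q n \<ge> 1"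
    using n(1) by (simp_all add: Suc_le_eq prime_multiplicity_gt_zero_iff)
  moreover have "n = p ^ multiplicity p n * q ^ multiplicity q n"
    using prime_factorization_nat[OF n(1)] pq by simp
  ultimately show ?thesis using that pq(2) by blast
qed

theorem theorem3p10:
  fixes n :: nat
  assumes "n > 0" and "card (prime_factors n) \<ge> 2"
  shows "girth (intersection_hypergraph (integer_mod_group n)) =
    (if (\<exists>p1 p2 \<alpha>1 :: nat. prime p1 \<and> prime p2 \<and> p1 \<noteq> p2 \<and> \<alpha>1 \<ge> 1 \<and> n = p1 ^ \<alpha>1 * p2) \<or>
        (\<exists>p1 p2 p3 :: nat. prime p1 \<and> prime p2 \<and> prime p3 \<and>
           p1 \<noteq> p2 \<and> p1 \<noteq> p3 \<and> p2 \<noteq> p3 \<and> n = p1 * p2 * p3)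
     then \<infinity>
     else if \<exists>p1 p2 \<alpha>1 \<alpha>2 :: nat. prime p1 \<and> prime p2 \<and> p1 \<noteq> p2 \<and>
           \<alpha>1 \<ge> 2 \<and> \<alpha>2 \<ge> 2 \<and> n = p1 ^ \<alpha>1 * p2 ^ \<alpha>2
     then 4
     else 2)"
proof -
  have girth: "girth (intersection_hypergraph (integer_mod_group n)) = girth (divisor_hypergraph n)"
  proof -
    have "inj_on (torsion n) (fst (divisor_hypergraph n))"
      by (rule inj_on_subset[OF inj_on_torsion[OF assms(1)]])
        (auto simp: divisor_hypergraph_def vertex_divisors_def)
    moreover have "\<Union> (snd (divisor_hypergraph n)) \<subseteq> fst (divisor_hypergraph n)"
      by (auto simp: divisor_hypergraph_def)
    ultimately show ?thesis
      using girth_image intersection_hypergraph_integer_mod_group[OF assms] by fastforce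
  qed
  let ?two = "\<exists>p1 p2 \<alpha>1 :: nat. prime p1 \<and> prime p2 \<and> p1 \<noteq> p2 \<and> \<alpha>1 \<ge> 1 \<and> n = p1 ^ \<alpha>1 * p2"
  let ?three = "\<exists>p1 p2 p3 :: nat. prime p1 \<and> prime p2 \<and> prime p3 \<and>
           p1 \<noteq> p2 \<and> p1 \<noteq> p3 \<and> p2 \<noteq> p3 \<and> n = p1 * p2 * p3"
  let ?four = "\<exists>p1 p2 \<alpha>1 \<alpha>2 :: nat. prime p1 \<and> prime p2 \<and> p1 \<noteq> p2 \<and>
           \<alpha>1 \<ge> 2 \<and> \<alpha>2 \<ge> 2 \<and> n = p1 ^ \<alpha>1 * p2 ^ \<alpha>2"
  have inf: "girth (divisor_hypergraph n) = \<infinity>" if "?two \<or> ?three"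
    using that girth_divisor_hypergraph_two_primes_infinity girth_divisor_hypergraph_three_primes
    by (elim disjE exE conjE) simp_all
  have 4: "girth (divisor_hypergraph n) = 4" if ?four
    using that girth_divisor_hypergraph_two_primes_4 by (elim exE conjE) simp
  have 2: "girth (divisor_hypergraph n) = 2" if "\<not> (?two \<or> ?three)" "\<not> ?four"
  proof (rule girth_divisor_hypergraph_otherwise[OF assms(1)])
    \<comment> \<open>With only two primes, either some exponent is 1, which is \<open>?two\<close>
      after possibly swapping the primes, or both are at least 2, which is
      \<open>?four\<close>.\<close>
    have "card (prime_factors n) \<noteq> 2"
    proof
      assume "card (prime_factors n) = 2"
      then obtain p q a b where pq: "prime p" "prime q" "p \<noteq> q" "a \<ge> 1" "b \<ge> 1" "n = p ^ a * q ^ b"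
        using card_prime_factors_2_cases[OF assms(1)] by blast
      consider "a = 1" | "b = 1" | "a \<ge> 2" "b \<ge> 2" using pq by linarith
      then show False
      proof cases
        case 1
        then have "n = q ^ b * p" using pq by simp
        with that(1) pq show False by metis
      next
        case 2
        then have "n = p ^ a * q" using pq by simp
        with that(1) pq show False by metis
      next
        case 3
        with that(2) pq show False by metis
      qed
    qed
    then show "card (prime_factors n) \<ge> 3" using assms(2) by simp
  qed (use that in metis)
  show ?thesis
    unfolding girth using inf 4 2 by (simp only: if_True if_False split: if_split) blast
qed

end
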